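(* Transport $T$ via $\varepsilon$ to an antilinear map of $(H\otimes R)\oplus(H^*\otimes R^* )$. Then this map is a sum $A_1\otimes B_1+A_2\otimes B_2$ of two pure tensors of $\mathbb C$-antilinear maps, as follows. - If $T$ is mixing: $A_1\otimes B_1:H\otimes R\to H^*\otimes R^*$ with $A_1:H\to H^*$ and $B_1:R\to R^*$, and $A_2\otimes B_2:H^*\otimes R^*\to H\otimes R$ with $A_2:H^*\to H$ and $B_2:R^*\to R$. - If $T$ is nonmixing: $A_1\otimes B_1:H\otimes R\to H\otimes R$ with $A_1:H\to H$ and $B_1:R\to R$, and $A_2\otimes B_2:H^*\otimes R^*\to H^*\otimes R^*$ with $A_2:H^*\to H^*$ and $B_2:R^*\to R^*$.
   Context: Setting: - $G_0$ is a compact group, and $R$ is a finite-dimensional irreducible unitary $G_0$-representation with a $G_0$-invariant Hermitian inner product $\langle\,,\rangle_R$. - $V$ is a finite-dimensional unitary $G_0$-representation with inner product $\langle\,,\rangle_V$, all of whose irreducible subrepresentations are isomorphic to $R$. Duals carry the action $g(f)=f\circ g^{-1}$. - $W=V\oplus V^*$, with antilinear $C:W\to W$ given by $C(v)=\langle v,\cdot\rangle_V$ on $V$ and $C|_{V^*}=(C|_V)^{-1}$. The unitary structure on $V^*$ is transported by $C$. - $H=\mathrm{Hom}_{G_0}(R,V)$, $H^*=\mathrm{Hom}_{G_0}(R^*,V^* )$, and $\varepsilon:(H\otimes R)\oplus(H^*\otimes R^* )\to W$, $h\otimes r+f\otimes t\mapsto h(r)+f(t)$, which is a $G_0$-equivariant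 isomorphism. - The Hermitian form on $H$ is defined by $\langle h_1(r_1),h_2(r_2)\rangle_V=\langle h_1,h_2\rangle_H\langle r_1,r_2\rangle_R$, and similarly on $H^*$. - $T:W\to W$ is an antiunitary operator commuting with $C$, and there is an automorphism $a$ of $G_0$ such that $T\circ g=a(g)\circ T$ on $W$ for all $g\in G_0$. - $T$ is either mixing ($T(V)=V^*$, $T(V^* )=V$) or nonmixing ($T(V)=V$, $T(V^* )=V^*$). For antilinear maps $A,B$, the map $A\otimes B$ is defined by $(A\otimes B)(x\otimes y)=A(x)\otimes B(y)$. *)

theory Defs
  imports "HOL-Analysis.Analysis" "HOL-Algebra.Group"
begin

text \<open>Finite-dimensional complex vector spaces are modelled in coordinates as
  complex^'n; complex-linear maps between them as matrices; the dual space of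
  complex^'n is modelled as complex^'n via the evaluation pairing dual_eval.\<close>

definition dual_eval :: "complex^'n \<Rightarrow> complex^'n \<Rightarrow> complex" where
  "dual_eval f v = (\<Sum>i\<in>UNIV. f$i * v$i)"

definition mscale :: "complex \<Rightarrow> complex^'m^'n \<Rightarrow> complex^'m^'n" where
  "mscale c X = (\<chi> i. c *s X$i)"

text \<open>Antilinear maps (defined on a subset S, w.r.t. given complex scalings).\<close>
definition antilinear_on ::
  "(complex \<Rightarrow> 'a \<Rightarrow> 'a) \<Rightarrow> (complex \<Rightarrow> 'b \<Rightarrow> 'b) \<Rightarrow> 'a set \<Rightarrow> ('a::plus \<Rightarrow> 'b::plus) \<Rightarrow> bool" where
  "antilinear_on sc1 sc2 S f \<longleftrightarrow>
     (\<forall>x\<in>S. \<forall>y\<in>S. f (x + y) = f x + f y) \<and>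
     (\<forall>c. \<forall>x\<in>S. f (sc1 c x) = sc2 (cnj c) (f x))"

text \<open>Hermitian inner product: linear in the 2nd, antilinear in the 1st argument.\<close>
definition herm_ip :: "(complex^'n \<Rightarrow> complex^'n \<Rightarrow> complex) \<Rightarrow> bool" where
  "herm_ip ip \<longleftrightarrow>
     (\<forall>x y z. ip x (y + z) = ip x y + ip x z) \<and>
     (\<forall>c x y. ip x (c *s y) = c * ip x y) \<and>
     (\<forall>x y. ip y x = cnj (ip x y)) \<and>
     (\<forall>x. x \<noteq> 0 \<longrightarrow> 0 < Re (ip x x))"

text \<open>Compact (Hausdorff) topological group.\<close>
definition compact_group :: "('g, 'b) monoid_scheme \<Rightarrow> 'g topology \<Rightarrow> bool" where
  "compact_group G X \<longleftrightarrow> group G \<and> topspace X = carrier G \<and> compact_space X \<and>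
     Hausdorff_space X \<and>
     continuous_map (prod_topology X X) X (\<lambda>(x, y). x \<otimes>\<^bsub>G\<^esub> y) \<and>
     continuous_map X X (\<lambda>x. inv\<^bsub>G\<^esub> x)"

text \<open>Continuous finite-dimensional unitary representation rho of G on complex^'n
  with G-invariant Hermitian inner product ip.\<close>
definition unitary_rep ::
  "('g, 'b) monoid_scheme \<Rightarrow> 'g topology \<Rightarrow> ('g \<Rightarrow> complex^'n^'n)
     \<Rightarrow> (complex^'n \<Rightarrow> complex^'n \<Rightarrow> complex) \<Rightarrow> bool" where
  "unitary_rep G X rho ip \<longleftrightarrow>
     (\<forall>g\<in>carrier G. \<forall>h\<in>carrier G. rho (g \<otimes>\<^bsub>G\<^esub> h) = rho g ** rho h) \<and>
     rho \<one>\<^bsub>G\<^esub> = mat 1 \<and>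
     continuous_map X euclidean rho \<and>
     herm_ip ip \<and>
     (\<forall>g\<in>carrier G. \<forall>x y. ip (rho g *v x) (rho g *v y) = ip x y)"

definition csubspace :: "(complex^'n) set \<Rightarrow> bool" where
  "csubspace S \<longleftrightarrow> 0 \<in> S \<and> (\<forall>x\<in>S. \<forall>y\<in>S. x + y \<in> S) \<and> (\<forall>c. \<forall>x\<in>S. c *s x \<in> S)"

definition invariant_sub ::
  "('g, 'b) monoid_scheme \<Rightarrow> ('g \<Rightarrow> complex^'n^'n) \<Rightarrow> (complex^'n) set \<Rightarrow> bool" where
  "invariant_sub G rho S \<longleftrightarrow> csubspace S \<and> (\<forall>g\<in>carrier G. \<forall>x\<in>S. rho g *v x \<in> S)"

text \<open>Irreducible subrepresentation S (a nonzero invariant subspace with no proper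
  nonzero invariant subspaces).\<close>
definition irreducible_sub ::
  "('g, 'b) monoid_scheme \<Rightarrow> ('g \<Rightarrow> complex^'n^'n) \<Rightarrow> (complex^'n) set \<Rightarrow> bool" where
  "irreducible_sub G rho S \<longleftrightarrow> invariant_sub G rho S \<and> S \<noteq> {0} \<and>
     (\<forall>S'. S' \<subseteq> S \<and> invariant_sub G rho S' \<longrightarrow> S' = {0} \<or> S' = S)"

definition irreducible_rep :: "('g, 'b) monoid_scheme \<Rightarrow> ('g \<Rightarrow> complex^'n^'n) \<Rightarrow> bool" where
  "irreducible_rep G rho \<longleftrightarrow> irreducible_sub G rho UNIV"

text \<open>The subrepresentation S of (complex^'n, rhoV) is isomorphic to (complex^'m, rhoR).\<close>
definition iso_to_sub ::
  "('g, 'b) monoid_scheme \<Rightarrow> ('g \<Rightarrow> complex^'m^'m) \<Rightarrow> ('g \<Rightarrow> complex^'n^'n)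
     \<Rightarrow> (complex^'n) set \<Rightarrow> bool" where
  "iso_to_sub G rhoR rhoV S \<longleftrightarrow>
     (\<exists>P :: complex^'m^'n. bij_betw (\<lambda>r. P *v r) UNIV S \<and>
        (\<forall>g\<in>carrier G. \<forall>r. rhoV g *v (P *v r) = P *v (rhoR g *v r)))"

text \<open>Dual representation g(f) = f o g^-1, in the coordinates of dual_eval.\<close>
definition dual_rep :: "('g, 'b) monoid_scheme \<Rightarrow> ('g \<Rightarrow> complex^'n^'n) \<Rightarrow> 'g \<Rightarrow> complex^'n^'n" where
  "dual_rep G rho g = transpose (rho (inv\<^bsub>G\<^esub> g))"

text \<open>Representation on W = V + V*.\<close>
definition rep_W :: "('g, 'b) monoid_scheme \<Rightarrow> ('g \<Rightarrow> complex^'n^'n) \<Rightarrow> 'g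
     \<Rightarrow> (complex^'n) \<times> (complex^'n) \<Rightarrow> (complex^'n) \<times> (complex^'n)" where
  "rep_W G rho g w = (rho g *v fst w, dual_rep G rho g *v snd w)"

text \<open>C on V: v maps to the functional ip v (-).\<close>
definition C_V :: "(complex^'n \<Rightarrow> complex^'n \<Rightarrow> complex) \<Rightarrow> complex^'n \<Rightarrow> complex^'n" where
  "C_V ip v = (THE f. \<forall>w. dual_eval f w = ip v w)"

text \<open>C on W: C on V, and its inverse on V*.\<close>
definition C_W :: "(complex^'n \<Rightarrow> complex^'n \<Rightarrow> complex)
     \<Rightarrow> (complex^'n) \<times> (complex^'n) \<Rightarrow> (complex^'n) \<times> (complex^'n)" where
  "C_W ip w = (the_inv (C_V ip) (snd w), C_V ip (fst w))"

text \<open>Inner product on W: orthogonal sum, the one on V* transported by C so that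
  C is antiunitary: <C v1, C v2> = <v2, v1>.\<close>
definition ip_W :: "(complex^'n \<Rightarrow> complex^'n \<Rightarrow> complex)
     \<Rightarrow> (complex^'n) \<times> (complex^'n) \<Rightarrow> (complex^'n) \<times> (complex^'n) \<Rightarrow> complex" where
  "ip_W ip w1 w2 = ip (fst w1) (fst w2)
      + ip (the_inv (C_V ip) (snd w2)) (the_inv (C_V ip) (snd w1))"

definition scale_W :: "complex \<Rightarrow> (complex^'n) \<times> (complex^'n) \<Rightarrow> (complex^'n) \<times> (complex^'n)" where
  "scale_W c w = (c *s fst w, c *s snd w)"

definition antiunitary_W :: "(complex^'n \<Rightarrow> complex^'n \<Rightarrow> complex)
     \<Rightarrow> ((complex^'n) \<times> (complex^'n) \<Rightarrow> (complex^'n) \<times> (complex^'n)) \<Rightarrow> bool" where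
  "antiunitary_W ip T \<longleftrightarrow> antilinear_on scale_W scale_W UNIV T \<and> surj T \<and>
     (\<forall>x y. ip_W ip (T x) (T y) = cnj (ip_W ip x y))"

definition V_part :: "((complex^'n) \<times> (complex^'n)) set" where
  "V_part = {(v, 0) | v. True}"

definition Vd_part :: "((complex^'n) \<times> (complex^'n)) set" where
  "Vd_part = {(0, f) | f. True}"

text \<open>H = Hom_G(R, V) and H* = Hom_G(R*, V*), as matrices.\<close>
definition Hom_H :: "('g, 'b) monoid_scheme \<Rightarrow> ('g \<Rightarrow> complex^'m^'m) \<Rightarrow> ('g \<Rightarrow> complex^'n^'n)
     \<Rightarrow> (complex^'m^'n) set" where
  "Hom_H G rhoR rhoV = {X. \<forall>g\<in>carrier G. rhoV g ** X = X ** rhoR g}"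

definition Hom_Hd :: "('g, 'b) monoid_scheme \<Rightarrow> ('g \<Rightarrow> complex^'m^'m) \<Rightarrow> ('g \<Rightarrow> complex^'n^'n)
     \<Rightarrow> (complex^'m^'n) set" where
  "Hom_Hd G rhoR rhoV = {Y. \<forall>g\<in>carrier G. dual_rep G rhoV g ** Y = Y ** dual_rep G rhoR g}"

end

theory Submission
  imports Defs
begin

text \<open>Because T commutes with G up to the automorphism a, each of its four blocks between V
  and V* is an antilinear map intertwining a representation with another one twisted by a.
  An injective a-twisted semilinear map of V (in the mixing case, the block V* \<rightarrow> V composed
  with C), restricted to an irreducible subrepresentation isomorphic to R, has an irreducible
  image, again isomorphic to R; this yields an a-twisted semilinear bijection of R, and composing with the Riesz map R \<rightarrow> R* gives a-twisted antilinear
  bijections B between R and R*. For a block \<Phi> and such a B, the map A(h) = \<Phi> \<circ> h \<circ> B\<inverse> is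
  complex-linear, sends intertwiners to intertwiners and satisfies \<Phi>(h r) = A(h)(B r).\<close>

definition semilinear :: "(complex \<Rightarrow> complex) \<Rightarrow> (complex^'a \<Rightarrow> complex^'b) \<Rightarrow> bool" where
  "semilinear s f \<longleftrightarrow> (\<forall>x y. f (x + y) = f x + f y) \<and> (\<forall>c x. f (c *s x) = s c *s f x)"

lemma semilinear_add: "semilinear s f \<Longrightarrow> f (x + y) = f x + f y"
  unfolding semilinear_def by blast

lemma semilinear_scale: "semilinear s f \<Longrightarrow> f (c *s x) = s c *s f x"
  unfolding semilinear_def by blast

lemma semilinear_zero: "semilinear s f \<Longrightarrow> f 0 = 0"
  using semilinear_add[of s f 0 0] by simp

lemma semilinear_comp: "semilinear s f \<Longrightarrow> semilinear t g \<Longrightarrow> semilinear (s \<circ> t) (f \<circ> g)"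
  unfolding semilinear_def by auto

lemma semilinear_matrix_vector_mult: "semilinear id ((*v) (A :: complex^'a^'b))"
  by (simp add: semilinear_def matrix_vector_right_distrib vector_scalar_commute)

lemma semilinear_id_imp_linear: "semilinear id f \<Longrightarrow> Vector_Spaces.linear (*s) (*s) f"
  unfolding semilinear_def by (simp add: Vector_Spaces.linear_iff vec.vector_space_axioms)

lemma semilinear_cnj_iff_antilinear_on: "semilinear cnj f \<longleftrightarrow> antilinear_on (*s) (*s) UNIV f"
  unfolding semilinear_def antilinear_on_def by blast

lemma cnj_comp_cnj [simp]: "cnj \<circ> cnj = id"
  by (simp add: fun_eq_iff)

lemma scaleR_eq_complex_scale: "r *\<^sub>R (x :: complex^'a) = complex_of_real r *s x"
  unfolding vec_eq_iff vector_scaleR_component vector_smult_component by (simp add: scaleR_conv_of_real)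

lemma semilinear_imp_real_linear:
  assumes "semilinear s f" "s \<in> {id, cnj}"
  shows "linear f"
  using assms by (intro linearI) (auto simp: scaleR_eq_complex_scale semilinear_add semilinear_scale)

lemma semilinear_inj_imp_bij:
  fixes f :: "complex^'a \<Rightarrow> complex^'a"
  assumes "semilinear s f" "s \<in> {id, cnj}" "inj f"
  shows "bij f"
  using linear_injective_imp_surjective[OF semilinear_imp_real_linear[OF assms(1,2)] assms(3)] assms(3)
  by (simp add: bij_def)

lemma semilinear_inv:
  fixes f :: "complex^'a \<Rightarrow> complex^'a"
  assumes f: "semilinear s f" and s: "s \<in> {id, cnj}" and "bij f"
  shows "semilinear s (inv_into UNIV f)"
proof -
  have f_inv: "f (inv_into UNIV f y) = y" for y using \<open>bij f\<close> by (simp add: bij_is_surj surj_f_inv_f)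
  have "inj f" using \<open>bij f\<close> bij_is_inj by blast
  moreover have "s (s c) = c" for c using s by auto
  ultimately show ?thesis
    unfolding semilinear_def
    by (metis f_inv injD semilinear_add[OF f] semilinear_scale[OF f])
qed

definition twisted_equivariant ::
  "('g, 'b) monoid_scheme \<Rightarrow> ('g \<Rightarrow> 'g) \<Rightarrow> ('g \<Rightarrow> complex^'a^'a) \<Rightarrow> ('g \<Rightarrow> complex^'c^'c)
     \<Rightarrow> (complex^'a \<Rightarrow> complex^'c) \<Rightarrow> bool" where
  "twisted_equivariant G a rho1 rho2 f \<longleftrightarrow>
     (\<forall>g\<in>carrier G. \<forall>x. f (rho1 g *v x) = rho2 (a g) *v f x)"

lemma twisted_equivariantD:
  "twisted_equivariant G a rho1 rho2 f \<Longrightarrow> g \<in> carrier G \<Longrightarrow> f (rho1 g *v x) = rho2 (a g) *v f x"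
  unfolding twisted_equivariant_def by blast

lemma twisted_equivariant_comp:
  assumes "twisted_equivariant G b rho2 rho3 f" "twisted_equivariant G a rho1 rho2 g"
    and "a ` carrier G \<subseteq> carrier G"
  shows "twisted_equivariant G (b \<circ> a) rho1 rho3 (f \<circ> g)"
  using assms unfolding twisted_equivariant_def by auto

lemma twisted_equivariant_inv:
  assumes "twisted_equivariant G id rho1 rho2 f" "bij f"
  shows "twisted_equivariant G id rho2 rho1 (inv_into UNIV f)"
  unfolding twisted_equivariant_def
  by (metis assms bij_inv_eq_iff id_apply twisted_equivariantD)

lemma antilinear_on_subset: "antilinear_on s1 s2 UNIV f \<Longrightarrow> antilinear_on s1 s2 S f"
  unfolding antilinear_on_def by blast

lemma Hom_Hd_eq_Hom_H_dual: "Hom_Hd G rhoR rhoV = Hom_H G (dual_rep G rhoR) (dual_rep G rhoV)"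
  unfolding Hom_H_def Hom_Hd_def ..

lemma herm_ip_add_left: "herm_ip ip \<Longrightarrow> ip (x + y) z = ip x z + ip y z"
  unfolding herm_ip_def by (metis complex_cnj_add)

lemma herm_ip_add_right: "herm_ip ip \<Longrightarrow> ip z (x + y) = ip z x + ip z y"
  unfolding herm_ip_def by metis

lemma herm_ip_scale_left: "herm_ip ip \<Longrightarrow> ip (c *s y) z = cnj c * ip y z"
  unfolding herm_ip_def by (metis complex_cnj_mult)

lemma herm_ip_scale_right: "herm_ip ip \<Longrightarrow> ip z (c *s y) = c * ip z y"
  unfolding herm_ip_def by metis

lemma herm_ip_pos: "herm_ip ip \<Longrightarrow> x \<noteq> 0 \<Longrightarrow> 0 < Re (ip x x)"
  unfolding herm_ip_def by metis

lemma herm_ip_zero_right: "herm_ip ip \<Longrightarrow> ip z 0 = 0"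
  using herm_ip_scale_right[of ip z 0 0] by simp

lemma herm_ip_sum_right: "herm_ip ip \<Longrightarrow> ip z (\<Sum>i\<in>A. f i) = (\<Sum>i\<in>A. ip z (f i))"
  by (induction A rule: infinite_finite_induct) (simp_all add: herm_ip_zero_right herm_ip_add_right)

lemma herm_ip_expand_right: "herm_ip ip \<Longrightarrow> ip z w = (\<Sum>i\<in>UNIV. w$i * ip z (axis i 1))"
  by (subst basis_expansion[of w, symmetric]) (simp add: herm_ip_sum_right herm_ip_scale_right)

text \<open>riesz ip v is the functional ip v (-) in the coordinates of dual_eval, i.e. the map C on V.\<close>
definition riesz :: "(complex^'n \<Rightarrow> complex^'n \<Rightarrow> complex) \<Rightarrow> complex^'n \<Rightarrow> complex^'n" where
  "riesz ip v = (\<chi> i. ip v (axis i 1))"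

lemma semilinear_riesz: "herm_ip ip \<Longrightarrow> semilinear cnj (riesz ip)"
  unfolding semilinear_def riesz_def by (simp add: vec_eq_iff herm_ip_add_left herm_ip_scale_left)

lemma inj_riesz:
  assumes ip: "herm_ip ip" shows "inj (riesz ip)"
proof (rule injI)
  fix x y assume "riesz ip x = riesz ip y"
  then have "riesz ip (x - y) = 0"
    using semilinear_add[OF semilinear_riesz[OF ip], of "x - y" y] by simp
  then have "ip (x - y) (axis i 1) = 0" for i
    unfolding riesz_def vec_eq_iff by simp
  then have "ip (x - y) (x - y) = 0"
    by (simp add: herm_ip_expand_right[OF ip, of "x - y" "x - y"])
  then show "x = y" using herm_ip_pos[OF ip, of "x - y"] by auto
qed

lemma bij_riesz: "herm_ip ip \<Longrightarrow> bij (riesz ip)"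
  by (rule semilinear_inj_imp_bij[OF semilinear_riesz _ inj_riesz]) auto

lemma unitary_rep_inverse:
  assumes "group G" "unitary_rep G X rho ip" "g \<in> carrier G"
  shows "rho g ** rho (inv\<^bsub>G\<^esub> g) = mat 1"
  using assms unfolding unitary_rep_def by (metis group.inv_closed group.r_inv)

lemma twisted_equivariant_riesz:
  assumes G: "group G" and rho: "unitary_rep G X rho ip"
  shows "twisted_equivariant G id rho (dual_rep G rho) (riesz ip)"
  unfolding twisted_equivariant_def
proof (intro ballI allI)
  fix g v assume g: "g \<in> carrier G"
  have ip: "herm_ip ip" using rho unfolding unitary_rep_def by blast
  show "riesz ip (rho g *v v) = dual_rep G rho (id g) *v riesz ip v"
  proof (subst vec_eq_iff, rule allI)
    fix i
    have "ip (rho g *v v) (axis i 1) = ip (rho g *v v) (rho g *v (rho (inv\<^bsub>G\<^esub> g) *v axis i 1))"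
      by (simp add: matrix_vector_mul_assoc unitary_rep_inverse[OF G rho g])
    also have "\<dots> = ip v (rho (inv\<^bsub>G\<^esub> g) *v axis i 1)"
      using rho g unfolding unitary_rep_def by blast
    also have "\<dots> = (\<Sum>j\<in>UNIV. rho (inv\<^bsub>G\<^esub> g) $ j $ i * ip v (axis j 1))"
      by (subst herm_ip_expand_right[OF ip])
        (simp add: matrix_vector_mult_def axis_def if_distrib if_distribR cong: if_cong)
    finally show "riesz ip (rho g *v v) $ i = (dual_rep G rho (id g) *v riesz ip v) $ i"
      by (simp add: riesz_def dual_rep_def matrix_vector_mult_def transpose_def)
  qed
qed

lemma csubspace_imp_subspace: "csubspace S \<Longrightarrow> subspace S"
  unfolding csubspace_def subspace_def by (simp add: scaleR_eq_complex_scale)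

text \<open>A nonzero invariant subspace of least dimension is irreducible.\<close>
lemma irreducible_sub_exists:
  fixes rho :: "'g \<Rightarrow> complex^'n^'n"
  shows "\<exists>S. irreducible_sub G rho S"
proof -
  let ?P = "\<lambda>d. \<exists>S. invariant_sub G rho S \<and> S \<noteq> {0} \<and> dim S = d"
  have "invariant_sub G rho UNIV" unfolding invariant_sub_def csubspace_def by simp
  moreover have "(UNIV :: (complex^'n) set) \<noteq> {0}"
    by (metis axis_eq_0_iff one_neq_zero singletonD UNIV_I)
  ultimately have "\<exists>d. ?P d" by blast
  then obtain d where "?P d" and d_min: "\<And>d'. d' < d \<Longrightarrow> \<not> ?P d'"
    using exists_least_iff[of ?P] by blast
  then obtain S where S: "invariant_sub G rho S" "S \<noteq> {0}" "dim S = d" by blast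
  have "S' = {0} \<or> S' = S" if S': "S' \<subseteq> S" "invariant_sub G rho S'" for S'
  proof (rule ccontr)
    assume "\<not> (S' = {0} \<or> S' = S)"
    moreover have "subspace S'" "subspace S"
      using S(1) S'(2) csubspace_imp_subspace unfolding invariant_sub_def by auto
    ultimately have "dim S' \<noteq> dim S"
      using S'(1) subspace_dim_equal[of S' S] by (metis order.refl)
    then have "dim S' < dim S"
      using S'(1) dim_subset[of S' S] by linarith
    then show False using d_min S S' \<open>\<not> (S' = {0} \<or> S' = S)\<close> by blast
  qed
  then show ?thesis using S unfolding irreducible_sub_def by blast
qed

lemma irreducible_sub_range:
  fixes F :: "complex^'m \<Rightarrow> complex^'n"
  assumes a: "bij_betw a (carrier G) (carrier G)" and R: "irreducible_rep G rhoR"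
    and F: "semilinear s F" "s \<in> {id, cnj}" "inj F" "twisted_equivariant G a rhoR rhoV F"
  shows "irreducible_sub G rhoV (range F)"
proof -
  note F_add = semilinear_add[OF F(1)] and F_scale = semilinear_scale[OF F(1)]
    and F_zero = semilinear_zero[OF F(1)] and F_equiv = twisted_equivariantD[OF F(4)]
  have "csubspace (range F)"
    unfolding csubspace_def
  proof (intro conjI ballI allI)
    show "0 \<in> range F" by (metis F_zero rangeI)
    show "x + y \<in> range F" if "x \<in> range F" "y \<in> range F" for x y
      using that by (auto simp: F_add[symmetric])
    show "c *s x \<in> range F" if "x \<in> range F" for c x
    proof -
      have "c *s F r = F (s c *s r)" for r using F(2) by (auto simp: F_scale)
      then show ?thesis using that by auto
    qed
  qed
  moreover have "rhoV g *v x \<in> range F" if g: "g \<in> carrier G" and x: "x \<in> range F" for g x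
  proof -
    have "g \<in> a ` carrier G" using bij_betw_imp_surj_on[OF a] g by simp
    then obtain g' where "g' \<in> carrier G" "g = a g'" by (elim imageE)
    moreover obtain r where "x = F r" using x by (elim rangeE)
    ultimately show ?thesis by (simp add: F_equiv[symmetric])
  qed
  ultimately have invariant: "invariant_sub G rhoV (range F)"
    unfolding invariant_sub_def by (intro conjI ballI)
  have "axis undefined 1 \<noteq> (0 :: complex^'m)"
    by (simp add: axis_eq_0_iff)
  then have "F (axis undefined 1) \<noteq> 0"
    using F(3) F_zero by (metis injD)
  then have nonzero: "range F \<noteq> {0}" by blast
  have "S' = {0} \<or> S' = range F" if S': "S' \<subseteq> range F" "invariant_sub G rhoV S'" for S'
  proof -
    define preimage where "preimage = {r. F r \<in> S'}"
    have "invariant_sub G rhoR preimage"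
      using S'(2) bij_betwE[OF a] unfolding invariant_sub_def csubspace_def preimage_def
      by (simp add: F_zero F_add F_scale F_equiv)
    then have "preimage = {0} \<or> preimage = UNIV"
      using R unfolding irreducible_rep_def irreducible_sub_def by blast
    moreover have "S' = F ` preimage" using S'(1) unfolding preimage_def by blast
    ultimately show ?thesis using F_zero by auto
  qed
  then show ?thesis
    using invariant nonzero unfolding irreducible_sub_def by blast
qed

text \<open>N = Q\<inverse> \<circ> M \<circ> P compares two copies P(R) and M(P(R)) of R inside V.\<close>
lemma twisted_semilinear_bij_of_irreducible:
  fixes rhoR :: "'g \<Rightarrow> complex^'m^'m" and rhoV :: "'g \<Rightarrow> complex^'n^'n"
  assumes a: "bij_betw a (carrier G) (carrier G)" and R: "irreducible_rep G rhoR"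
    and V: "\<forall>S. irreducible_sub G rhoV S \<longrightarrow> iso_to_sub G rhoR rhoV S"
    and M: "semilinear s M" "s \<in> {id, cnj}" "inj M" "twisted_equivariant G a rhoV rhoV M"
  shows "\<exists>N. semilinear s N \<and> bij N \<and> twisted_equivariant G a rhoR rhoR N"
proof -
  obtain S where "irreducible_sub G rhoV S" using irreducible_sub_exists by blast
  then obtain P :: "complex^'m^'n" where P: "bij_betw ((*v) P) UNIV S"
      "twisted_equivariant G id rhoR rhoV ((*v) P)"
    using V unfolding iso_to_sub_def twisted_equivariant_def by auto
  define F where "F = M \<circ> (*v) P"
  have F: "semilinear s F" "inj F" "twisted_equivariant G a rhoR rhoV F"
    using semilinear_comp[OF M(1) semilinear_matrix_vector_mult]
      twisted_equivariant_comp[OF M(4) P(2)] M(3) P(1)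
    by (auto simp: F_def bij_betw_def inj_compose)
  then have "irreducible_sub G rhoV (range F)"
    using irreducible_sub_range[OF a R _ M(2)] by blast
  then obtain Q :: "complex^'m^'n" where Q: "bij_betw ((*v) Q) UNIV (range F)"
      "twisted_equivariant G id rhoR rhoV ((*v) Q)"
    using V unfolding iso_to_sub_def twisted_equivariant_def by auto
  define N where "N r = inv_into UNIV ((*v) Q) (F r)" for r
  have Q_N: "Q *v N r = F r" for r
    unfolding N_def using Q(1) by (metis bij_betw_def f_inv_into_f rangeI)
  have Q_cancel: "x = y" if "Q *v x = Q *v y" for x y
    using Q(1) that by (auto simp: bij_betw_def inj_def)
  have "semilinear s N"
    unfolding semilinear_def
    by (auto intro!: Q_cancel simp: Q_N semilinear_add[OF F(1)] semilinear_scale[OF F(1)]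
        matrix_vector_right_distrib vector_scalar_commute)
  moreover have "inj N" by (rule injI) (metis Q_N F(2) injD)
  moreover have "twisted_equivariant G a rhoR rhoR N"
    using Q(2) F(3) bij_betwE[OF a]
    by (auto intro!: Q_cancel simp: Q_N twisted_equivariant_def)
  ultimately show ?thesis using semilinear_inj_imp_bij M(2) by blast
qed

lemma mscale_matrix_vector_mult: "mscale c h *v y = c *s (h *v y)"
  by (simp add: mscale_def vec_eq_iff matrix_vector_mult_def sum_distrib_left mult.assoc)

text \<open>The factor A(h) is the matrix of the complex-linear map \<Phi> \<circ> h \<circ> B\<inverse>.\<close>
lemma twisted_block_factorization:
  fixes Phi :: "complex^'n \<Rightarrow> complex^'n" and B :: "complex^'m \<Rightarrow> complex^'m"
  assumes a: "bij_betw a (carrier G) (carrier G)"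
    and Phi: "semilinear cnj Phi" "twisted_equivariant G a rhoA rhoB Phi"
    and B: "semilinear cnj B" "bij B" "twisted_equivariant G a tauA tauB B"
  shows "\<exists>A. A ` Hom_H G tauA rhoA \<subseteq> Hom_H G tauB rhoB \<and> antilinear_on mscale mscale UNIV A \<and>
    (\<forall>h r. A h *v B r = Phi (h *v r))"
proof -
  define Binv where "Binv = inv_into UNIV B"
  have Binv: "semilinear cnj Binv" unfolding Binv_def using semilinear_inv[OF B(1) _ B(2)] by simp
  have Binv_B: "Binv (B r) = r" for r unfolding Binv_def using B(2) by (simp add: bij_is_inj)
  have B_Binv: "B (Binv y) = y" for y
    unfolding Binv_def using B(2) by (simp add: bij_is_surj surj_f_inv_f)
  have Binv_equiv: "Binv (tauB (a g) *v y) = tauA g *v Binv y" if "g \<in> carrier G" for g y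
    by (metis B_Binv Binv_B twisted_equivariantD[OF B(3) that])
  define A where "A h = matrix (Phi \<circ> (*v) h \<circ> Binv)" for h
  have A_apply: "A h *v y = Phi (h *v Binv y)" for h y
  proof -
    have "semilinear ((cnj \<circ> id) \<circ> cnj) (Phi \<circ> (*v) h \<circ> Binv)"
      by (intro semilinear_comp Phi(1) Binv semilinear_matrix_vector_mult)
    then show ?thesis
      unfolding A_def by (simp add: matrix_works semilinear_id_imp_linear)
  qed
  have "A h \<in> Hom_H G tauB rhoB" if h: "h \<in> Hom_H G tauA rhoA" for h
    unfolding Hom_H_def
  proof (intro CollectI ballI)
    fix g' assume "g' \<in> carrier G"
    then obtain g where g: "g \<in> carrier G" "g' = a g"
      using bij_betw_imp_surj_on[OF a] by (metis imageE)
    show "rhoB g' ** A h = A h ** tauB g'"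
    proof (rule iffD2[OF matrix_eq], rule allI)
      fix y
      have "(A h ** tauB g') *v y = Phi (h *v (tauA g *v Binv y))"
        by (simp add: matrix_vector_mul_assoc[symmetric] A_apply Binv_equiv g)
      also have "\<dots> = Phi (rhoA g *v (h *v Binv y))"
        using h g(1) unfolding Hom_H_def by (simp add: matrix_vector_mul_assoc)
      also have "\<dots> = (rhoB g' ** A h) *v y"
        by (simp add: twisted_equivariantD[OF Phi(2) g(1)] g(2) A_apply
            matrix_vector_mul_assoc[symmetric])
      finally show "(rhoB g' ** A h) *v y = (A h ** tauB g') *v y" by simp
    qed
  qed
  moreover have "antilinear_on mscale mscale UNIV A"
    unfolding antilinear_on_def
    by (simp add: matrix_eq A_apply matrix_vector_mult_add_rdistrib mscale_matrix_vector_mult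
        semilinear_add[OF Phi(1)] semilinear_scale[OF Phi(1)] del: vec_eq_iff)
  moreover have "A h *v B r = Phi (h *v r)" for h r
    by (simp add: A_apply Binv_B)
  ultimately show ?thesis by blast
qed

locale antiunitary_symmetry =
  fixes G :: "('g, 'b) monoid_scheme" and X :: "'g topology" and a :: "'g \<Rightarrow> 'g"
    and rhoR :: "'g \<Rightarrow> complex^'m^'m" and ipR :: "complex^'m \<Rightarrow> complex^'m \<Rightarrow> complex"
    and rhoV :: "'g \<Rightarrow> complex^'n^'n" and ipV :: "complex^'n \<Rightarrow> complex^'n \<Rightarrow> complex"
    and T :: "(complex^'n) \<times> (complex^'n) \<Rightarrow> (complex^'n) \<times> (complex^'n)"
  assumes group: "group G"
    and a_bij: "bij_betw a (carrier G) (carrier G)"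
    and R_unitary: "unitary_rep G X rhoR ipR"
    and R_irreducible: "irreducible_rep G rhoR"
    and V_unitary: "unitary_rep G X rhoV ipV"
    and V_isotypic: "\<forall>S. irreducible_sub G rhoV S \<longrightarrow> iso_to_sub G rhoR rhoV S"
    and T_antilinear: "antilinear_on scale_W scale_W UNIV T"
    and T_inj: "inj T"
    and T_twisted: "\<forall>g\<in>carrier G. \<forall>w. T (rep_W G rhoV g w) = rep_W G rhoV (a g) (T w)"
begin

text \<open>The blocks of T with respect to W = V \<oplus> V*: T_XY maps X into Y, with Vd standing for V*.\<close>
definition "T_VV v = fst (T (v, 0))"
definition "T_VVd v = snd (T (v, 0))"
definition "T_VdV f = fst (T (0, f))"
definition "T_VdVd f = snd (T (0, f))"

lemmas T_block_defs = T_VV_def T_VVd_def T_VdV_def T_VdVd_def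

lemma T_add: "T (x + y) = T x + T y"
  using T_antilinear unfolding antilinear_on_def by blast

lemma T_scale: "T (scale_W c x) = scale_W (cnj c) (T x)"
  using T_antilinear unfolding antilinear_on_def by blast

lemma semilinear_T_blocks:
  "semilinear cnj T_VV" "semilinear cnj T_VVd" "semilinear cnj T_VdV" "semilinear cnj T_VdVd"
  unfolding semilinear_def T_block_defs
  using T_add[of "(_, 0)" "(_, 0)"] T_scale[of _ "(_, 0)"] T_add[of "(0, _)" "(0, _)"]
    T_scale[of _ "(0, _)"]
  by (auto simp: scale_W_def)

lemma twisted_equivariant_T_blocks:
  "twisted_equivariant G a rhoV rhoV T_VV"
  "twisted_equivariant G a rhoV (dual_rep G rhoV) T_VVd"
  "twisted_equivariant G a (dual_rep G rhoV) rhoV T_VdV"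
  "twisted_equivariant G a (dual_rep G rhoV) (dual_rep G rhoV) T_VdVd"
  using T_twisted[rule_format, of _ "(_, 0)"] T_twisted[rule_format, of _ "(0, _)"]
  unfolding twisted_equivariant_def T_block_defs by (auto simp: rep_W_def)

lemma mem_V_part_iff: "w \<in> V_part \<longleftrightarrow> snd w = 0"
  unfolding V_part_def by (cases w) auto

lemma mem_Vd_part_iff: "w \<in> Vd_part \<longleftrightarrow> fst w = 0"
  unfolding Vd_part_def by (cases w) auto

lemma T_mixing_blocks:
  assumes "T ` V_part = Vd_part" "T ` Vd_part = V_part"
  shows "T (v, 0) = (0, T_VVd v)" "T (0, f) = (T_VdV f, 0)"
proof -
  have "T (v, 0) \<in> Vd_part" "T (0, f) \<in> V_part"
    using assms by (auto simp: mem_V_part_iff mem_Vd_part_iff)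
  then show "T (v, 0) = (0, T_VVd v)" "T (0, f) = (T_VdV f, 0)"
    unfolding T_block_defs mem_V_part_iff mem_Vd_part_iff by (simp_all add: prod_eq_iff)
qed

lemma T_nonmixing_blocks:
  assumes "T ` V_part = V_part" "T ` Vd_part = Vd_part"
  shows "T (v, 0) = (T_VV v, 0)" "T (0, f) = (0, T_VdVd f)"
proof -
  have "T (v, 0) \<in> V_part" "T (0, f) \<in> Vd_part"
    using assms by (auto simp: mem_V_part_iff mem_Vd_part_iff)
  then show "T (v, 0) = (T_VV v, 0)" "T (0, f) = (0, T_VdVd f)"
    unfolding T_block_defs mem_V_part_iff mem_Vd_part_iff by (simp_all add: prod_eq_iff)
qed

lemma riesz_R:
  "semilinear cnj (riesz ipR)" "bij (riesz ipR)"
  "twisted_equivariant G id rhoR (dual_rep G rhoR) (riesz ipR)"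
  using R_unitary semilinear_riesz bij_riesz twisted_equivariant_riesz[OF group]
  unfolding unitary_rep_def by blast+

lemma riesz_R_inv:
  "semilinear cnj (inv_into UNIV (riesz ipR))" "bij (inv_into UNIV (riesz ipR))"
  "twisted_equivariant G id (dual_rep G rhoR) rhoR (inv_into UNIV (riesz ipR))"
  using semilinear_inv[OF riesz_R(1) _ riesz_R(2)] bij_imp_bij_inv[OF riesz_R(2)]
    twisted_equivariant_inv[OF riesz_R(3,2)] by auto

lemma a_closed: "a ` carrier G \<subseteq> carrier G"
  using a_bij bij_betw_imp_surj_on by blast

lemma mixing_twisted_bijections:
  assumes "T ` V_part = Vd_part" "T ` Vd_part = V_part"
  obtains B1 B2 where
    "semilinear cnj B1" "bij B1" "twisted_equivariant G a rhoR (dual_rep G rhoR) B1"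
    "semilinear cnj B2" "bij B2" "twisted_equivariant G a (dual_rep G rhoR) rhoR B2"
proof -
  have V: "herm_ip ipV" using V_unitary unfolding unitary_rep_def by blast
  have "inj T_VdV"
    using T_inj T_mixing_blocks[OF assms] by (metis injD injI prod.inject)
  then have "semilinear id (T_VdV \<circ> riesz ipV)" "inj (T_VdV \<circ> riesz ipV)"
      "twisted_equivariant G a rhoV rhoV (T_VdV \<circ> riesz ipV)"
    using semilinear_comp[OF semilinear_T_blocks(3) semilinear_riesz[OF V]] inj_riesz[OF V]
      twisted_equivariant_comp[OF twisted_equivariant_T_blocks(3)
        twisted_equivariant_riesz[OF group V_unitary]]
    by (auto simp: inj_compose)
  then obtain L where L: "semilinear id L" "bij L" "twisted_equivariant G a rhoR rhoR L"
    using twisted_semilinear_bij_of_irreducible[OF a_bij R_irreducible V_isotypic] by blast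
  show thesis
  proof
    show "semilinear cnj (riesz ipR \<circ> L)" using semilinear_comp[OF riesz_R(1) L(1)] by simp
    show "bij (riesz ipR \<circ> L)" using riesz_R(2) L(2) by (rule bij_comp[rotated])
    show "twisted_equivariant G a rhoR (dual_rep G rhoR) (riesz ipR \<circ> L)"
      using twisted_equivariant_comp[OF riesz_R(3) L(3) a_closed] by simp
    show "semilinear cnj (L \<circ> inv_into UNIV (riesz ipR))"
      using semilinear_comp[OF L(1) riesz_R_inv(1)] by simp
    show "bij (L \<circ> inv_into UNIV (riesz ipR))" using L(2) riesz_R_inv(2) by (rule bij_comp[rotated])
    show "twisted_equivariant G a (dual_rep G rhoR) rhoR (L \<circ> inv_into UNIV (riesz ipR))"
      using twisted_equivariant_comp[OF L(3) riesz_R_inv(3)] by simp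
  qed
qed

lemma nonmixing_twisted_bijections:
  assumes "T ` V_part = V_part" "T ` Vd_part = Vd_part"
  obtains B1 B2 where
    "semilinear cnj B1" "bij B1" "twisted_equivariant G a rhoR rhoR B1"
    "semilinear cnj B2" "bij B2" "twisted_equivariant G a (dual_rep G rhoR) (dual_rep G rhoR) B2"
proof -
  have "inj T_VV"
    using T_inj T_nonmixing_blocks[OF assms] by (metis injD injI prod.inject)
  then obtain K where K: "semilinear cnj K" "bij K" "twisted_equivariant G a rhoR rhoR K"
    using twisted_semilinear_bij_of_irreducible[OF a_bij R_irreducible V_isotypic
        semilinear_T_blocks(1) _ _ twisted_equivariant_T_blocks(1)] by blast
  let ?B2 = "riesz ipR \<circ> K \<circ> inv_into UNIV (riesz ipR)"
  show thesis
  proof (rule that[of K ?B2])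
    show "semilinear cnj ?B2"
      using semilinear_comp[OF semilinear_comp[OF riesz_R(1) K(1)] riesz_R_inv(1)] by simp
    show "bij ?B2" using riesz_R(2) K(2) riesz_R_inv(2) by (simp add: bij_comp)
    show "twisted_equivariant G a (dual_rep G rhoR) (dual_rep G rhoR) ?B2"
      using twisted_equivariant_comp[OF twisted_equivariant_comp[OF riesz_R(3) K(3) a_closed]
          riesz_R_inv(3)] by simp
  qed (use K in auto)
qed

lemma mixing_factorization:
  assumes mixing: "T ` V_part = Vd_part" "T ` Vd_part = V_part"
  shows "\<exists>(A1 :: complex^'m^'n \<Rightarrow> complex^'m^'n) (B1 :: complex^'m \<Rightarrow> complex^'m)
            (A2 :: complex^'m^'n \<Rightarrow> complex^'m^'n) (B2 :: complex^'m \<Rightarrow> complex^'m).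
            A1 ` Hom_H G rhoR rhoV \<subseteq> Hom_Hd G rhoR rhoV \<and>
            antilinear_on mscale mscale (Hom_H G rhoR rhoV) A1 \<and>
            antilinear_on (*s) (*s) UNIV B1 \<and>
            A2 ` Hom_Hd G rhoR rhoV \<subseteq> Hom_H G rhoR rhoV \<and>
            antilinear_on mscale mscale (Hom_Hd G rhoR rhoV) A2 \<and>
            antilinear_on (*s) (*s) UNIV B2 \<and>
            (\<forall>h\<in>Hom_H G rhoR rhoV. \<forall>r. T (h *v r, 0) = (0, A1 h *v B1 r)) \<and>
            (\<forall>f\<in>Hom_Hd G rhoR rhoV. \<forall>t. T (0, f *v t) = (A2 f *v B2 t, 0))"
proof -
  obtain B1 B2
    where B1: "semilinear cnj B1" "bij B1" "twisted_equivariant G a rhoR (dual_rep G rhoR) B1"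
    and B2: "semilinear cnj B2" "bij B2" "twisted_equivariant G a (dual_rep G rhoR) rhoR B2"
    using mixing_twisted_bijections[OF mixing] .
  obtain A1 where A1: "A1 ` Hom_H G rhoR rhoV \<subseteq> Hom_Hd G rhoR rhoV"
      "antilinear_on mscale mscale UNIV A1" "\<And>h r. A1 h *v B1 r = T_VVd (h *v r)"
    using twisted_block_factorization[OF a_bij semilinear_T_blocks(2)
        twisted_equivariant_T_blocks(2) B1]
    unfolding Hom_Hd_eq_Hom_H_dual by blast
  obtain A2 where A2: "A2 ` Hom_Hd G rhoR rhoV \<subseteq> Hom_H G rhoR rhoV"
      "antilinear_on mscale mscale UNIV A2" "\<And>h r. A2 h *v B2 r = T_VdV (h *v r)"
    using twisted_block_factorization[OF a_bij semilinear_T_blocks(3)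
        twisted_equivariant_T_blocks(3) B2]
    unfolding Hom_Hd_eq_Hom_H_dual by blast
  show ?thesis
    by (rule exI[of _ A1], rule exI[of _ B1], rule exI[of _ A2], rule exI[of _ B2])
      (simp add: A1 A2 antilinear_on_subset T_mixing_blocks[OF mixing]
        B1(1) B2(1) flip: semilinear_cnj_iff_antilinear_on)
qed

lemma nonmixing_factorization:
  assumes nonmixing: "T ` V_part = V_part" "T ` Vd_part = Vd_part"
  shows "\<exists>(A1 :: complex^'m^'n \<Rightarrow> complex^'m^'n) (B1 :: complex^'m \<Rightarrow> complex^'m)
            (A2 :: complex^'m^'n \<Rightarrow> complex^'m^'n) (B2 :: complex^'m \<Rightarrow> complex^'m).
            A1 ` Hom_H G rhoR rhoV \<subseteq> Hom_H G rhoR rhoV \<and>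
            antilinear_on mscale mscale (Hom_H G rhoR rhoV) A1 \<and>
            antilinear_on (*s) (*s) UNIV B1 \<and>
            A2 ` Hom_Hd G rhoR rhoV \<subseteq> Hom_Hd G rhoR rhoV \<and>
            antilinear_on mscale mscale (Hom_Hd G rhoR rhoV) A2 \<and>
            antilinear_on (*s) (*s) UNIV B2 \<and>
            (\<forall>h\<in>Hom_H G rhoR rhoV. \<forall>r. T (h *v r, 0) = (A1 h *v B1 r, 0)) \<and>
            (\<forall>f\<in>Hom_Hd G rhoR rhoV. \<forall>t. T (0, f *v t) = (0, A2 f *v B2 t))"
proof -
  obtain B1 B2 where B1: "semilinear cnj B1" "bij B1" "twisted_equivariant G a rhoR rhoR B1"
    and B2: "semilinear cnj B2" "bij B2"
      "twisted_equivariant G a (dual_rep G rhoR) (dual_rep G rhoR) B2"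
    using nonmixing_twisted_bijections[OF nonmixing] .
  obtain A1 where A1: "A1 ` Hom_H G rhoR rhoV \<subseteq> Hom_H G rhoR rhoV"
      "antilinear_on mscale mscale UNIV A1" "\<And>h r. A1 h *v B1 r = T_VV (h *v r)"
    using twisted_block_factorization[OF a_bij semilinear_T_blocks(1)
        twisted_equivariant_T_blocks(1) B1]
    by blast
  obtain A2 where A2: "A2 ` Hom_Hd G rhoR rhoV \<subseteq> Hom_Hd G rhoR rhoV"
      "antilinear_on mscale mscale UNIV A2" "\<And>h r. A2 h *v B2 r = T_VdVd (h *v r)"
    using twisted_block_factorization[OF a_bij semilinear_T_blocks(4)
        twisted_equivariant_T_blocks(4) B2]
    unfolding Hom_Hd_eq_Hom_H_dual by blast
  show ?thesis
    by (rule exI[of _ A1], rule exI[of _ B1], rule exI[of _ A2], rule exI[of _ B2])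
      (simp add: A1 A2 antilinear_on_subset T_nonmixing_blocks[OF nonmixing]
        B1(1) B2(1) flip: semilinear_cnj_iff_antilinear_on)
qed

end

lemma antiunitary_W_imp_inj:
  assumes "antiunitary_W ip T" shows "inj T"
proof -
  have T: "antilinear_on scale_W scale_W UNIV T" "surj T"
    using assms unfolding antiunitary_W_def by auto
  have scaleR_W: "r *\<^sub>R w = scale_W (complex_of_real r) w" for r and w :: "(complex^'n) \<times> (complex^'n)"
    by (simp add: scale_W_def scaleR_eq_complex_scale prod_eq_iff)
  have T_scale: "T (scale_W c w) = scale_W (cnj c) (T w)" for c w
    using T(1) unfolding antilinear_on_def by blast
  have "linear T"
  proof (rule linearI)
    show "T (x + y) = T x + T y" for x y using T(1) unfolding antilinear_on_def by blast
    show "T (r *\<^sub>R x) = r *\<^sub>R T x" for r x by (simp add: scaleR_W T_scale)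
  qed
  then show ?thesis using linear_surjective_imp_injective T(2) by blast
qed

theorem proposition3p5:
  fixes G :: "('g, 'b) monoid_scheme" and X :: "'g topology"
    and rhoR :: "'g \<Rightarrow> complex^'m^'m" and ipR :: "complex^'m \<Rightarrow> complex^'m \<Rightarrow> complex"
    and rhoV :: "'g \<Rightarrow> complex^'n^'n" and ipV :: "complex^'n \<Rightarrow> complex^'n \<Rightarrow> complex"
    and T :: "(complex^'n) \<times> (complex^'n) \<Rightarrow> (complex^'n) \<times> (complex^'n)"
    and a :: "'g \<Rightarrow> 'g"
  assumes "compact_group G X"
    and "unitary_rep G X rhoR ipR" and "irreducible_rep G rhoR"
    and "unitary_rep G X rhoV ipV"
    and "\<forall>S. irreducible_sub G rhoV S \<longrightarrow> iso_to_sub G rhoR rhoV S"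
    and "antiunitary_W ipV T"
    and "T \<circ> C_W ipV = C_W ipV \<circ> T"
    and "a \<in> iso G G"
    and "\<forall>g\<in>carrier G. \<forall>w. T (rep_W G rhoV g w) = rep_W G rhoV (a g) (T w)"
    and "(T ` V_part = Vd_part \<and> T ` Vd_part = V_part) \<or> (T ` V_part = V_part \<and> T ` Vd_part = Vd_part)"
  shows "(T ` V_part = Vd_part \<and> T ` Vd_part = V_part \<longrightarrow>
           (\<exists>(A1 :: complex^'m^'n \<Rightarrow> complex^'m^'n) (B1 :: complex^'m \<Rightarrow> complex^'m)
              (A2 :: complex^'m^'n \<Rightarrow> complex^'m^'n) (B2 :: complex^'m \<Rightarrow> complex^'m).
              A1 ` Hom_H G rhoR rhoV \<subseteq> Hom_Hd G rhoR rhoV \<and>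
              antilinear_on mscale mscale (Hom_H G rhoR rhoV) A1 \<and>
              antilinear_on (*s) (*s) UNIV B1 \<and>
              A2 ` Hom_Hd G rhoR rhoV \<subseteq> Hom_H G rhoR rhoV \<and>
              antilinear_on mscale mscale (Hom_Hd G rhoR rhoV) A2 \<and>
              antilinear_on (*s) (*s) UNIV B2 \<and>
              (\<forall>h\<in>Hom_H G rhoR rhoV. \<forall>r. T (h *v r, 0) = (0, A1 h *v B1 r)) \<and>
              (\<forall>f\<in>Hom_Hd G rhoR rhoV. \<forall>t. T (0, f *v t) = (A2 f *v B2 t, 0))))
       \<and> (T ` V_part = V_part \<and> T ` Vd_part = Vd_part \<longrightarrow>
           (\<exists>(A1 :: complex^'m^'n \<Rightarrow> complex^'m^'n) (B1 :: complex^'m \<Rightarrow> complex^'m)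
              (A2 :: complex^'m^'n \<Rightarrow> complex^'m^'n) (B2 :: complex^'m \<Rightarrow> complex^'m).
              A1 ` Hom_H G rhoR rhoV \<subseteq> Hom_H G rhoR rhoV \<and>
              antilinear_on mscale mscale (Hom_H G rhoR rhoV) A1 \<and>
              antilinear_on (*s) (*s) UNIV B1 \<and>
              A2 ` Hom_Hd G rhoR rhoV \<subseteq> Hom_Hd G rhoR rhoV \<and>
              antilinear_on mscale mscale (Hom_Hd G rhoR rhoV) A2 \<and>
              antilinear_on (*s) (*s) UNIV B2 \<and>
              (\<forall>h\<in>Hom_H G rhoR rhoV. \<forall>r. T (h *v r, 0) = (A1 h *v B1 r, 0)) \<and>
              (\<forall>f\<in>Hom_Hd G rhoR rhoV. \<forall>t. T (0, f *v t) = (0, A2 f *v B2 t))))"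
proof -
  have "group G" using assms(1) unfolding compact_group_def by blast
  moreover have "bij_betw a (carrier G) (carrier G)" using assms(8) unfolding iso_def by blast
  moreover have "antilinear_on scale_W scale_W UNIV T" using assms(6) unfolding antiunitary_W_def by blast
  moreover have "inj T" using assms(6) by (rule antiunitary_W_imp_inj)
  ultimately interpret antiunitary_symmetry G X a rhoR ipR rhoV ipV T
    using assms(2-5,9) unfolding antiunitary_symmetry_def by blast
  show ?thesis using mixing_factorization nonmixing_factorization by blast
qed

end
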